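(* Let $Q,R,S\in\mathfrak{P}$ and let $\rho$ be a strong I-scheme from $Q\times R$ to $Q\times S$ such that (a) for all $P\in\mathfrak{P}_r$, $\xi,\zeta\in\mathcal{H}(P,Q)$, $\theta\in\mathcal{H}(P,R)$: $\xi\ne\zeta$ implies $\rho_P(\xi,\theta)_1\ne\rho_P(\zeta,\theta)_1$; and (b) for all $P\in\mathfrak{P}_r$ and $\xi\in\mathcal{H}(P,Q\times R)$: if $\xi_1\in\mathcal{C}(P)$ then $\rho_P(\xi)_1\in\mathcal{C}(P)$. Fix $q\in Q$; for $P\in\mathfrak{P}_r$, $\xi\in\mathcal{H}(P,R)$ let $\phi_P^0(\xi):=c_{P,q}$, $\phi_P^i(\xi):=\rho_P(\phi_P^{i-1}(\xi),\xi)_1$ ($i\in\mathbb{N}$), $\Phi_P^i(\xi):=(\phi_P^i(\xi),\xi)$, let $n_P(\xi)\in\mathbb{N}$ satisfy $\phi_P^{n_P(\xi)}(\xi)=c_{P,q}$ (such integers exist), and let $\tau_P(\xi):=\rho_P(\Phi_P^{n_P(\xi)-1}(\xi))_2$. Then $R\sqsubseteq_I S$, and $\tau=(\tau_P)_{P\in\mathfrak{P}_r}$ is a strong I-scheme from $R$ to $S$.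
   Context: $\mathfrak{P}$ is the class of finite nonempty posets and $\mathfrak{P}_r$ a fixed system of representatives of its isomorphism classes; $\mathbb{N}=\{1,2,\dots\}$. $\mathcal{H}(P,Q)$ is the set of order-preserving maps $P\to Q$; $Q\times R$ is the product poset. For $\xi\in\mathcal{H}(P,Q)$, $\theta\in\mathcal{H}(P,R)$, $(\xi,\theta)$ is $x\mapsto(\xi(x),\theta(x))$; for a map $\mu$ into a product, $\mu_1,\mu_2$ denote its components. $c_{P,q}$ is the constant map $P\to Q$ with value $q$, and $\mathcal{C}(P)=\{c_{P,q}:q\in Q\}$. For $A\subseteq P$, $x\in A$: $\gamma_A(x)$ is the set of $y\in A$ joined to $x$ by a sequence $x=z_0,\dots,z_L=y$ in $A$ ($L\ge0$) with consecutive elements strictly comparable; for a map $\xi$ on $P$, $G_\xi(x):=\gamma_{\xi^{-1}(\xi(x))}(x)$. For $A\subseteq P$, ${\downarrow^{\circ}}A:=\{y: y\le a\text{ for some }a\in A\}\setminus A$, ${\uparrow_{\circ}}A:=\{y: y\ge a\text{ for some }a\in A\}\setminus A$. The EV-system $\mathcal{E}(P)$ is the set of triples $(x,D,U)$ with $x\in P$, $D\subseteq{\downarrow^{\circ}}\{x\}$, $U\subseteq{\uparrow_{\circ}}\{x\}$; $\mathfrak a<_+\mathfrak b$ iff $\mathfrak a_1\in\mathfrak b_2$ and $\mathfrak b_1\in\mathfrak a_3$; $\le_+$ is $<_+$ plus equality. For $\xi\in\mathcal{H}(P,Q)$, $\alpha_{P,\xi}(x):=(\xi(x),\xi({\downarrow^{\circ}}G_\xi(x)),\xi({\uparrow_{\circ}}G_\xi(x)))$.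 A Hom-scheme from $A$ to $B$ is a family $(\rho_P)_{P\in\mathfrak{P}_r}$ of maps $\rho_P:\mathcal{H}(P,A)\to\mathcal{H}(P,B)$; strong if each $\rho_P$ is injective; an I-scheme if for all $P,P'\in\mathfrak{P}_r$, $\xi\in\mathcal{H}(P,A)$, $\zeta\in\mathcal{H}(P',A)$, $x\in P$, $y\in P'$: $\alpha_{P,\xi}(x)\le_+\alpha_{P',\zeta}(y)$ implies $\alpha_{P,\rho_P(\xi)}(x)\le_+\alpha_{P',\rho_{P'}(\zeta)}(y)$, with $<_+$ preserved. $R\sqsubseteq_I S$ means a strong I-scheme from $R$ to $S$ exists. *)

theory Defs
  imports Main "HOL-Library.FuncSet"
begin

text \<open>A poset is represented by its reflexive order relation \<open>P\<close>; its carrier is \<open>Field P\<close>.\<close>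

definition fin_poset :: "'a rel \<Rightarrow> bool" where
  "fin_poset P \<longleftrightarrow> Partial_order P \<and> finite (Field P) \<and> Field P \<noteq> {}"

definition poset_iso :: "'a rel \<Rightarrow> 'b rel \<Rightarrow> bool" where
  "poset_iso P P' \<longleftrightarrow>
     (\<exists>f. bij_betw f (Field P) (Field P') \<and>
          (\<forall>x\<in>Field P. \<forall>y\<in>Field P. (x, y) \<in> P \<longleftrightarrow> (f x, f y) \<in> P'))"

text \<open>A system of representatives of the isomorphism classes of finite nonempty posets. The posets
  on subsets of \<open>nat\<close> exhaust all isomorphism types, so the last clause covers finite posets over
  every type; see \<open>poset_reps_ex1\<close> below.\<close>

definition poset_reps :: "'p rel set \<Rightarrow> bool" where
  "poset_reps PP \<longleftrightarrow>
     (\<forall>P\<in>PP. fin_poset P) \<and>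
     (\<forall>P\<in>PP. \<forall>P'\<in>PP. poset_iso P P' \<longrightarrow> P = P') \<and>
     (\<forall>N::nat rel. fin_poset N \<longrightarrow> (\<exists>P\<in>PP. poset_iso N P))"

definition prod_poset :: "'a rel \<Rightarrow> 'b rel \<Rightarrow> ('a \<times> 'b) rel" where
  "prod_poset Q R = {((q, r), (q', r')) | q r q' r'. (q, q') \<in> Q \<and> (r, r') \<in> R}"

text \<open>All maps with domain \<open>P\<close> are extensional (\<open>undefined\<close> outside \<open>Field P\<close>), so that equality of
  HOL functions is equality of maps on \<open>P\<close>.\<close>

definition Homs :: "'p rel \<Rightarrow> 'a rel \<Rightarrow> ('p \<Rightarrow> 'a) set" where
  "Homs P A = {\<xi> \<in> Field P \<rightarrow>\<^sub>E Field A.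
     monotone_on (Field P) (\<lambda>x y. (x, y) \<in> P) (\<lambda>a b. (a, b) \<in> A) \<xi>}"

definition pair_map :: "'p rel \<Rightarrow> ('p \<Rightarrow> 'a) \<Rightarrow> ('p \<Rightarrow> 'b) \<Rightarrow> 'p \<Rightarrow> 'a \<times> 'b" where
  "pair_map P \<xi> \<theta> = (\<lambda>x\<in>Field P. (\<xi> x, \<theta> x))"

definition comp1 :: "'p rel \<Rightarrow> ('p \<Rightarrow> 'a \<times> 'b) \<Rightarrow> 'p \<Rightarrow> 'a" where
  "comp1 P \<mu> = (\<lambda>x\<in>Field P. fst (\<mu> x))"

definition comp2 :: "'p rel \<Rightarrow> ('p \<Rightarrow> 'a \<times> 'b) \<Rightarrow> 'p \<Rightarrow> 'b" where
  "comp2 P \<mu> = (\<lambda>x\<in>Field P. snd (\<mu> x))"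

definition const_map :: "'p rel \<Rightarrow> 'a \<Rightarrow> 'p \<Rightarrow> 'a" where
  "const_map P q = (\<lambda>x\<in>Field P. q)"

definition Consts :: "'p rel \<Rightarrow> 'a rel \<Rightarrow> ('p \<Rightarrow> 'a) set" where
  "Consts P Q = const_map P ` Field Q"

definition component :: "'p rel \<Rightarrow> 'p set \<Rightarrow> 'p \<Rightarrow> 'p set" where
  "component P A x =
     {y \<in> A. (x, y) \<in> {(u, v). u \<in> A \<and> v \<in> A \<and> u \<noteq> v \<and> ((u, v) \<in> P \<or> (v, u) \<in> P)}\<^sup>*}"

definition level_component :: "'p rel \<Rightarrow> ('p \<Rightarrow> 'a) \<Rightarrow> 'p \<Rightarrow> 'p set" where
  "level_component P \<xi> x = component P {z \<in> Field P. \<xi> z = \<xi> x} x"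

definition strict_down :: "'p rel \<Rightarrow> 'p set \<Rightarrow> 'p set" where
  "strict_down P A = {y. \<exists>a\<in>A. (y, a) \<in> P} - A"

definition strict_up :: "'p rel \<Rightarrow> 'p set \<Rightarrow> 'p set" where
  "strict_up P A = {y. \<exists>a\<in>A. (a, y) \<in> P} - A"

type_synonym 'a ev = "'a \<times> 'a set \<times> 'a set"

definition EV_system :: "'a rel \<Rightarrow> 'a ev set" where
  "EV_system P =
     {(x, D, U) | x D U. x \<in> Field P \<and> D \<subseteq> strict_down P {x} \<and> U \<subseteq> strict_up P {x}}"

text \<open>The relations on the EV-system depend only on the triples, not on the order of the poset, and
  are therefore defined on all triples; they are only ever applied to values of \<open>alpha\<close>, which lie
  in the EV-system by \<open>alpha_in_EV_system\<close> below.\<close>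

definition ev_less :: "'a ev \<Rightarrow> 'a ev \<Rightarrow> bool" where
  "ev_less a b \<longleftrightarrow> fst a \<in> fst (snd b) \<and> fst b \<in> snd (snd a)"

definition ev_le :: "'a ev \<Rightarrow> 'a ev \<Rightarrow> bool" where
  "ev_le a b \<longleftrightarrow> ev_less a b \<or> a = b"

definition alpha :: "'p rel \<Rightarrow> ('p \<Rightarrow> 'a) \<Rightarrow> 'p \<Rightarrow> 'a ev" where
  "alpha P \<xi> x =
     (\<xi> x, \<xi> ` strict_down P (level_component P \<xi> x), \<xi> ` strict_up P (level_component P \<xi> x))"

definition hom_scheme ::
  "'p rel set \<Rightarrow> 'a rel \<Rightarrow> 'b rel \<Rightarrow> ('p rel \<Rightarrow> ('p \<Rightarrow> 'a) \<Rightarrow> ('p \<Rightarrow> 'b)) \<Rightarrow> bool" where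
  "hom_scheme PP A B \<rho> \<longleftrightarrow> (\<forall>P\<in>PP. \<rho> P \<in> Homs P A \<rightarrow> Homs P B)"

definition strong_scheme ::
  "'p rel set \<Rightarrow> 'a rel \<Rightarrow> 'b rel \<Rightarrow> ('p rel \<Rightarrow> ('p \<Rightarrow> 'a) \<Rightarrow> ('p \<Rightarrow> 'b)) \<Rightarrow> bool" where
  "strong_scheme PP A B \<rho> \<longleftrightarrow> hom_scheme PP A B \<rho> \<and> (\<forall>P\<in>PP. inj_on (\<rho> P) (Homs P A))"

definition I_scheme ::
  "'p rel set \<Rightarrow> 'a rel \<Rightarrow> 'b rel \<Rightarrow> ('p rel \<Rightarrow> ('p \<Rightarrow> 'a) \<Rightarrow> ('p \<Rightarrow> 'b)) \<Rightarrow> bool" where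
  "I_scheme PP A B \<rho> \<longleftrightarrow> hom_scheme PP A B \<rho> \<and>
     (\<forall>P\<in>PP. \<forall>P'\<in>PP. \<forall>\<xi>\<in>Homs P A. \<forall>\<zeta>\<in>Homs P' A. \<forall>x\<in>Field P. \<forall>y\<in>Field P'.
        (ev_le (alpha P \<xi> x) (alpha P' \<zeta> y) \<longrightarrow>
           ev_le (alpha P (\<rho> P \<xi>) x) (alpha P' (\<rho> P' \<zeta>) y)) \<and>
        (ev_less (alpha P \<xi> x) (alpha P' \<zeta> y) \<longrightarrow>
           ev_less (alpha P (\<rho> P \<xi>) x) (alpha P' (\<rho> P' \<zeta>) y)))"

definition strong_I_scheme ::
  "'p rel set \<Rightarrow> 'a rel \<Rightarrow> 'b rel \<Rightarrow> ('p rel \<Rightarrow> ('p \<Rightarrow> 'a) \<Rightarrow> ('p \<Rightarrow> 'b)) \<Rightarrow> bool" where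
  "strong_I_scheme PP A B \<rho> \<longleftrightarrow> strong_scheme PP A B \<rho> \<and> I_scheme PP A B \<rho>"

definition I_below :: "'p rel set \<Rightarrow> 'a rel \<Rightarrow> 'b rel \<Rightarrow> bool" where
  "I_below PP R S \<longleftrightarrow> (\<exists>\<rho>. strong_I_scheme PP R S \<rho>)"

primrec phi ::
  "('p rel \<Rightarrow> ('p \<Rightarrow> 'q \<times> 'r) \<Rightarrow> ('p \<Rightarrow> 'q \<times> 's)) \<Rightarrow> 'q \<Rightarrow> 'p rel \<Rightarrow> ('p \<Rightarrow> 'r) \<Rightarrow> nat \<Rightarrow> 'p \<Rightarrow> 'q"
where
  "phi \<rho> q P \<xi> 0 = const_map P q"
| "phi \<rho> q P \<xi> (Suc i) = comp1 P (\<rho> P (pair_map P (phi \<rho> q P \<xi> i) \<xi>))"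

definition Phi ::
  "('p rel \<Rightarrow> ('p \<Rightarrow> 'q \<times> 'r) \<Rightarrow> ('p \<Rightarrow> 'q \<times> 's)) \<Rightarrow> 'q \<Rightarrow> 'p rel \<Rightarrow> ('p \<Rightarrow> 'r) \<Rightarrow> nat \<Rightarrow> 'p \<Rightarrow> 'q \<times> 'r"
where
  "Phi \<rho> q P \<xi> i = pair_map P (phi \<rho> q P \<xi> i) \<xi>"

definition is_return_index ::
  "('p rel \<Rightarrow> ('p \<Rightarrow> 'q \<times> 'r) \<Rightarrow> ('p \<Rightarrow> 'q \<times> 's)) \<Rightarrow> 'q \<Rightarrow> 'p rel \<Rightarrow> ('p \<Rightarrow> 'r) \<Rightarrow> nat \<Rightarrow> bool"
where
  "is_return_index \<rho> q P \<xi> n \<longleftrightarrow> 1 \<le> n \<and> phi \<rho> q P \<xi> n = const_map P q"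

definition tau ::
  "('p rel \<Rightarrow> ('p \<Rightarrow> 'q \<times> 'r) \<Rightarrow> ('p \<Rightarrow> 'q \<times> 's)) \<Rightarrow> 'q \<Rightarrow> ('p rel \<Rightarrow> ('p \<Rightarrow> 'r) \<Rightarrow> nat) \<Rightarrow>
     'p rel \<Rightarrow> ('p \<Rightarrow> 'r) \<Rightarrow> 'p \<Rightarrow> 's"
where
  "tau \<rho> q n P \<xi> = comp2 P (\<rho> P (Phi \<rho> q P \<xi> (n P \<xi> - 1)))"


lemma poset_iso_refl: "poset_iso P P"
  unfolding poset_iso_def by (rule exI[of _ id]) auto

lemma poset_iso_sym:
  assumes "poset_iso P P'"
  shows "poset_iso P' P"
proof -
  obtain f where f: "bij_betw f (Field P) (Field P')"
    and *: "\<forall>x\<in>Field P. \<forall>y\<in>Field P. (x, y) \<in> P \<longleftrightarrow> (f x, f y) \<in> P'"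
    using assms unfolding poset_iso_def by blast
  let ?g = "inv_into (Field P) f"
  have g: "bij_betw ?g (Field P') (Field P)"
    using f by (rule bij_betw_inv_into)
  have "(x, y) \<in> P' \<longleftrightarrow> (?g x, ?g y) \<in> P" if "x \<in> Field P'" "y \<in> Field P'" for x y
  proof -
    have "?g x \<in> Field P" "?g y \<in> Field P" "f (?g x) = x" "f (?g y) = y"
      using that f g by (auto simp: bij_betw_inv_into_right dest: bij_betwE)
    then show ?thesis using * by metis
  qed
  then show ?thesis unfolding poset_iso_def using g by blast
qed

lemma poset_iso_trans:
  assumes "poset_iso P P'" "poset_iso P' P''"
  shows "poset_iso P P''"
proof -
  obtain f where f: "bij_betw f (Field P) (Field P')"
    and *: "\<forall>x\<in>Field P. \<forall>y\<in>Field P. (x, y) \<in> P \<longleftrightarrow> (f x, f y) \<in> P'"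
    using assms(1) unfolding poset_iso_def by blast
  obtain g where g: "bij_betw g (Field P') (Field P'')"
    and **: "\<forall>x\<in>Field P'. \<forall>y\<in>Field P'. (x, y) \<in> P' \<longleftrightarrow> (g x, g y) \<in> P''"
    using assms(2) unfolding poset_iso_def by blast
  have "bij_betw (g \<circ> f) (Field P) (Field P'')"
    using f g by (rule bij_betw_trans)
  moreover have "\<forall>x\<in>Field P. \<forall>y\<in>Field P. (x, y) \<in> P \<longleftrightarrow> ((g \<circ> f) x, (g \<circ> f) y) \<in> P''"
    using * ** bij_betwE[OF f] by simp
  ultimately show ?thesis unfolding poset_iso_def by blast
qed

lemma fin_poset_iso_nat:
  fixes P :: "'a rel"
  assumes "fin_poset P"
  obtains N :: "nat rel" where "fin_poset N" "poset_iso P N"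
proof -
  have P: "refl_on (Field P) P" "trans P" "antisym P" "finite (Field P)" "Field P \<noteq> {}"
    using assms by (auto simp: fin_poset_def partial_order_on_def preorder_on_def)
  obtain f :: "'a \<Rightarrow> nat" where inj: "inj_on f (Field P)"
    using P(4) finite_imp_inj_to_nat_seg by blast
  define N where "N = map_prod f f ` P"
  have F: "Field N = f ` Field P"
    unfolding N_def Field_def by force
  have mem: "(x, y) \<in> P \<longleftrightarrow> (f x, f y) \<in> N" if "x \<in> Field P" "y \<in> Field P" for x y
  proof
    assume "(f x, f y) \<in> N"
    then obtain a b where ab: "(a, b) \<in> P" "f x = f a" "f y = f b"
      unfolding N_def by auto
    then have "x = a" "y = b"
      using that inj by (auto simp: inj_on_def FieldI1 FieldI2)
    then show "(x, y) \<in> P" using ab by simp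
  qed (force simp: N_def)
  have sub: "N \<subseteq> f ` Field P \<times> f ` Field P"
    unfolding N_def using FieldI1 FieldI2 by fastforce
  have "refl_on (Field N) N"
    using P(1) mem unfolding F refl_on_def by blast
  moreover have "trans N"
  proof (rule transI)
    fix u v w assume *: "(u, v) \<in> N" "(v, w) \<in> N"
    then obtain a b c where abc: "a \<in> Field P" "b \<in> Field P" "c \<in> Field P" "u = f a" "v = f b" "w = f c"
      using sub by blast
    then have "(a, b) \<in> P" "(b, c) \<in> P" using * mem by auto
    then have "(a, c) \<in> P" using P(2) by (blast dest: transD)
    then show "(u, w) \<in> N" using abc mem by blast
  qed
  moreover have "antisym N"
  proof (rule antisymI)
    fix u v assume *: "(u, v) \<in> N" "(v, u) \<in> N"
    then obtain a b where ab: "a \<in> Field P" "b \<in> Field P" "u = f a" "v = f b"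
      using sub by blast
    then have "(a, b) \<in> P" "(b, a) \<in> P" using * mem by auto
    then show "u = v" using P(3) ab by (blast dest: antisymD)
  qed
  ultimately have "fin_poset N"
    unfolding fin_poset_def partial_order_on_def preorder_on_def using P(4,5) sub by (auto simp: F)
  moreover have "poset_iso P N"
    unfolding poset_iso_def F using inj mem by (auto simp: bij_betw_def intro!: exI[of _ f])
  ultimately show ?thesis by (rule that)
qed

lemma poset_reps_ex1:
  fixes A :: "'a rel"
  assumes "poset_reps PP" "fin_poset A"
  shows "\<exists>!P. P \<in> PP \<and> poset_iso A P"
proof -
  obtain N :: "nat rel" where N: "fin_poset N" "poset_iso A N"
    using assms(2) by (rule fin_poset_iso_nat)
  then obtain P where "P \<in> PP" "poset_iso N P"
    using assms(1) unfolding poset_reps_def by blast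
  then show ?thesis
    using N assms(1) unfolding poset_reps_def by (meson poset_iso_sym poset_iso_trans)
qed

lemma poset_reps_exists: "\<exists>PP :: nat rel set. poset_reps PP"
proof -
  define c :: "nat rel \<Rightarrow> nat rel" where "c N = (SOME M. fin_poset M \<and> poset_iso N M)" for N
  have c: "fin_poset (c N) \<and> poset_iso N (c N)" if "fin_poset N" for N
    unfolding c_def by (rule someI[of _ N]) (simp add: that poset_iso_refl)
  have c_eq: "c N = c M" if "poset_iso N M" for N M
  proof -
    have "poset_iso N K \<longleftrightarrow> poset_iso M K" for K :: "nat rel"
      using that poset_iso_sym poset_iso_trans by blast
    then show ?thesis by (simp add: c_def)
  qed
  have "poset_reps (c ` {N. fin_poset N})"
    unfolding poset_reps_def
  proof (intro conjI ballI allI impI)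
    fix P P' assume "P \<in> c ` {N. fin_poset N}" "P' \<in> c ` {N. fin_poset N}" "poset_iso P P'"
    then show "P = P'"
      by (smt (verit, best) c c_eq image_iff mem_Collect_eq)
  qed (use c in auto)
  then show ?thesis by blast
qed

lemma fin_poset_prod_poset:
  assumes "fin_poset Q" "fin_poset R"
  shows "fin_poset (prod_poset Q R)" "Field (prod_poset Q R) = Field Q \<times> Field R"
proof -
  have Q: "refl_on (Field Q) Q" "trans Q" "antisym Q" "finite (Field Q)" "Field Q \<noteq> {}"
    and R: "refl_on (Field R) R" "trans R" "antisym R" "finite (Field R)" "Field R \<noteq> {}"
    using assms by (auto simp: fin_poset_def partial_order_on_def preorder_on_def)
  show F: "Field (prod_poset Q R) = Field Q \<times> Field R"
  proof (intro equalityI subsetI)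
    fix z assume "z \<in> Field Q \<times> Field R"
    then have "(z, z) \<in> prod_poset Q R"
      using Q(1) R(1) by (auto simp: prod_poset_def refl_on_def)
    then show "z \<in> Field (prod_poset Q R)" by (rule FieldI1)
  qed (auto simp: prod_poset_def Field_def)
  have "refl_on (Field (prod_poset Q R)) (prod_poset Q R)"
    unfolding F using Q(1) R(1) by (auto simp: prod_poset_def refl_on_def)
  moreover have "trans (prod_poset Q R)"
    using Q(2) R(2) unfolding prod_poset_def trans_def by blast
  moreover have "antisym (prod_poset Q R)"
    using Q(3) R(3) unfolding prod_poset_def antisym_def by blast
  ultimately show "fin_poset (prod_poset Q R)"
    using Q(4,5) R(4,5) F FieldI1 FieldI2
    unfolding fin_poset_def partial_order_on_def preorder_on_def by fastforce
qed

lemma alpha_in_EV_system: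
  assumes "\<xi> \<in> Homs P A" "x \<in> Field P"
  shows "alpha P \<xi> x \<in> EV_system A"
proof -
  let ?L = "{z \<in> Field P. \<xi> z = \<xi> x}" and ?G = "level_component P \<xi> x"
  have mono: "(\<xi> u, \<xi> v) \<in> A" if "(u, v) \<in> P" for u v
    using assms(1) that by (auto simp: Homs_def monotone_on_def FieldI1 FieldI2)
  have G: "g \<in> ?L" if "g \<in> ?G" for g
    using that by (auto simp: level_component_def component_def)
  have step: "y \<in> ?G" if "g \<in> ?G" "y \<in> ?L" "(y, g) \<in> P \<or> (g, y) \<in> P" for g y
    using that unfolding level_component_def component_def
    by (cases "g = y") (auto elim!: rtrancl_into_rtrancl)
  have "\<xi> y \<in> strict_down A {\<xi> x}" if y: "y \<in> strict_down P ?G" for y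
  proof -
    obtain g where g: "g \<in> ?G" "(y, g) \<in> P" "y \<notin> ?G"
      using y by (auto simp: strict_down_def)
    then show ?thesis using G[of g] step[of g y] mono[of y g]
      by (auto simp: strict_down_def FieldI1)
  qed
  moreover have "\<xi> y \<in> strict_up A {\<xi> x}" if y: "y \<in> strict_up P ?G" for y
  proof -
    obtain g where g: "g \<in> ?G" "(g, y) \<in> P" "y \<notin> ?G"
      using y by (auto simp: strict_up_def)
    then show ?thesis using G[of g] step[of g y] mono[of g y]
      by (auto simp: strict_up_def FieldI2)
  qed
  moreover have "\<xi> x \<in> Field A"
    using assms by (auto simp: Homs_def)
  ultimately show ?thesis
    by (auto simp: alpha_def EV_system_def)
qed

end

theory Submission
  imports Defs
begin

text \<open>For fixed \<open>\<theta>\<close>, hypothesis (a) makes \<open>\<xi> \<mapsto> \<rho>\<^sub>P(\<xi>, \<theta>)\<^sub>1\<close> an injective self-map of the finite set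
  \<open>\<H>(P, Q)\<close>, so every orbit returns to its starting point, and by (b) the orbit of \<open>c\<^sub>P\<^sub>,\<^sub>q\<close> consists of
  constant maps. Pairing a map with a constant \<open>c\<close> only attaches the tag \<open>c\<close> to its EV-triples, and
  triples with different tags are incomparable. As \<open>\<rho>\<close> preserves \<open>\<le>\<^sub>+\<close>, the orbits belonging to
  \<open>\<xi>\<close> and \<open>\<zeta>\<close> therefore run through the same constants as soon as some EV-triples of \<open>\<xi>\<close> and
  \<open>\<zeta>\<close> are comparable; by injectivity the predecessors of the return to \<open>q\<close> coincide too, whatever
  return indices are chosen. Since \<open>\<rho>\<^sub>P(\<Phi>\<^sub>P\<^sup>n\<^sup>-\<^sup>1(\<xi>)) = (c\<^sub>P\<^sub>,\<^sub>q, \<tau>\<^sub>P(\<xi>))\<close>, both injectivity and the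
  preservation of the relations pass from \<open>\<rho>\<close> to \<open>\<tau>\<close>.\<close>

section \<open>Order-preserving maps, constants and maps into a product\<close>

lemma Homs_extensional: "\<xi> \<in> Homs P A \<Longrightarrow> \<xi> \<in> extensional (Field P)"
  by (simp add: Homs_def PiE_iff)

lemma finite_Homs: "finite (Field P) \<Longrightarrow> finite (Field A) \<Longrightarrow> finite (Homs P A)"
  by (rule finite_subset[OF _ finite_PiE[of "Field P" "\<lambda>_. Field A"]]) (auto simp: Homs_def)

lemma const_map_in_Homs:
  assumes "fin_poset A" "a \<in> Field A"
  shows "const_map P a \<in> Homs P A"
  using assms
  by (auto simp: Homs_def const_map_def monotone_on_def fin_poset_def partial_order_on_def
      preorder_on_def refl_on_def)

text \<open>A finite poset in this sense is nonempty, so there is a point at which to compare the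
  values.\<close>

lemma const_map_eq_iff: "fin_poset P \<Longrightarrow> const_map P a = const_map P b \<longleftrightarrow> a = b"
  by (force simp: const_map_def fin_poset_def fun_eq_iff restrict_def)

lemma pair_map_in_Homs:
  assumes "fin_poset A" "fin_poset B" "\<xi> \<in> Homs P A" "\<theta> \<in> Homs P B"
  shows "pair_map P \<xi> \<theta> \<in> Homs P (prod_poset A B)"
  using assms(3,4) fin_poset_prod_poset(2)[OF assms(1,2)]
  by (auto simp: Homs_def pair_map_def monotone_on_def prod_poset_def)

lemma comp_in_Homs:
  assumes "fin_poset A" "fin_poset B" "\<mu> \<in> Homs P (prod_poset A B)"
  shows "comp1 P \<mu> \<in> Homs P A" "comp2 P \<mu> \<in> Homs P B"
proof -
  have "\<mu> x \<in> Field A \<times> Field B" if "x \<in> Field P" for x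
    using assms(3) that fin_poset_prod_poset(2)[OF assms(1,2)] by (auto simp: Homs_def)
  moreover have "(\<mu> x, \<mu> y) \<in> prod_poset A B" if "x \<in> Field P" "y \<in> Field P" "(x, y) \<in> P" for x y
    using assms(3) that by (auto simp: Homs_def monotone_on_def)
  ultimately show "comp1 P \<mu> \<in> Homs P A" "comp2 P \<mu> \<in> Homs P B"
    by (fastforce simp: Homs_def comp1_def comp2_def monotone_on_def prod_poset_def)+
qed

lemma comp_pair_map:
  assumes "\<xi> \<in> extensional (Field P)" "\<theta> \<in> extensional (Field P)"
  shows "comp1 P (pair_map P \<xi> \<theta>) = \<xi>" "comp2 P (pair_map P \<xi> \<theta>) = \<theta>"
  using assms by (auto simp: comp1_def comp2_def pair_map_def extensional_def fun_eq_iff)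

lemma pair_map_comp: "\<mu> \<in> extensional (Field P) \<Longrightarrow> pair_map P (comp1 P \<mu>) (comp2 P \<mu>) = \<mu>"
  by (auto simp: comp1_def comp2_def pair_map_def extensional_def fun_eq_iff)

section \<open>EV-triples of maps paired with a constant\<close>

definition tag :: "'a \<Rightarrow> 'b ev \<Rightarrow> ('a \<times> 'b) ev" where
  "tag c = map_prod (Pair c) (map_prod (image (Pair c)) (image (Pair c)))"

lemma alpha_pair_const:
  assumes "x \<in> Field P"
  shows "alpha P (pair_map P (const_map P c) \<xi>) x = tag c (alpha P \<xi> x)"
proof -
  let ?\<mu> = "pair_map P (const_map P c) \<xi>"
  have \<mu>: "?\<mu> z = (c, \<xi> z)" if "z \<in> Field P" for z
    using that by (simp add: pair_map_def const_map_def)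
  \<comment> \<open>A constant first coordinate does not change the level sets, hence not their
    components either.\<close>
  have G: "level_component P ?\<mu> x = level_component P \<xi> x"
    using assms unfolding level_component_def
    by (intro arg_cong[where f = "\<lambda>A. component P A x"]) (auto simp: \<mu>)
  \<comment> \<open>The formula for \<open>pair_map\<close> is valid only on \<open>Field P\<close>,
    so the sets whose images are taken must lie there.\<close>
  have "strict_down P A \<subseteq> Field P" "strict_up P A \<subseteq> Field P" for A
    by (auto simp: strict_down_def strict_up_def Field_def)
  then have "?\<mu> ` strict_down P A = Pair c ` \<xi> ` strict_down P A"
    "?\<mu> ` strict_up P A = Pair c ` \<xi> ` strict_up P A" for A
    unfolding image_image by (auto intro!: image_cong simp: \<mu> subset_iff)
  then show ?thesis
    by (simp add: alpha_def tag_def G \<mu> assms)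
qed

lemma ev_less_tag: "ev_less (tag c a) (tag d b) \<longleftrightarrow> c = d \<and> ev_less a b"
  by (cases a; cases b) (auto simp: ev_less_def tag_def)

text \<open>In the case of equality, the first entries reveal the tags, and taking images under the
  injective \<open>Pair c\<close> is itself injective on sets.\<close>

lemma ev_le_tag: "ev_le (tag c a) (tag d b) \<longleftrightarrow> c = d \<and> ev_le a b"
  unfolding ev_le_def ev_less_tag
  by (cases a; cases b) (auto simp: tag_def inj_image_eq_iff inj_on_def)

section \<open>Orbits of injective self-maps of a finite set\<close>

lemma orbit_returns:
  assumes "finite A" "inj_on f A" "f \<in> A \<rightarrow> A" "a \<in> A"
  shows "\<exists>n\<ge>1. (f ^^ n) a = a"
proof -
  have mem: "(f ^^ n) a \<in> A" for n
    by (induction n) (use assms(3,4) in auto)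
  \<comment> \<open>Pigeonhole: an injective sequence of iterates would embed the natural numbers
    into \<open>A\<close>.\<close>
  then have "\<not> inj (\<lambda>n. (f ^^ n) a)"
    using assms(1) by (metis finite_subset image_subsetI infinite_UNIV_nat finite_imageD)
  then obtain m n where eq: "(f ^^ m) a = (f ^^ n) a" and "m < n"
    unfolding inj_def by (metis linorder_neqE_nat)
  from eq \<open>m < n\<close> show ?thesis
  proof (induction m arbitrary: n)
    case 0
    then show ?case by (intro exI[of _ n]) auto
  next
    case (Suc m)
    \<comment> \<open>Both indices are successors, so one application of \<open>f\<close> cancels;
      repeating this brings the smaller index down to 0.\<close>
    then obtain k where k: "n = Suc k" "m < k" by (cases n) auto
    with Suc.prems(1) have "(f ^^ m) a = (f ^^ k) a"
      using assms(2) mem by (auto dest: inj_onD)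
    then show ?case using k(2) by (rule Suc.IH)
  qed
qed

text \<open>The choice \<open>n\<close> of return indices stays outside the context: their existence
  is proved inside it, and \<open>tau\<close> is treated for every choice.\<close>

locale constant_preserving_scheme =
  fixes PP :: "'p rel set"
    and Q :: "'q rel" and R :: "'r rel" and S :: "'s rel"
    and \<rho> :: "'p rel \<Rightarrow> ('p \<Rightarrow> 'q \<times> 'r) \<Rightarrow> ('p \<Rightarrow> 'q \<times> 's)"
    and q :: 'q
  assumes reps: "poset_reps PP"
    and Q: "fin_poset Q" and R: "fin_poset R" and S: "fin_poset S"
    and strong_I: "strong_I_scheme PP (prod_poset Q R) (prod_poset Q S) \<rho>"
    and comp1_neq: "\<forall>P\<in>PP. \<forall>\<xi>\<in>Homs P Q. \<forall>\<zeta>\<in>Homs P Q. \<forall>\<theta>\<in>Homs P R.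
           \<xi> \<noteq> \<zeta> \<longrightarrow>
             comp1 P (\<rho> P (pair_map P \<xi> \<theta>)) \<noteq> comp1 P (\<rho> P (pair_map P \<zeta> \<theta>))"
    and comp1_const: "\<forall>P\<in>PP. \<forall>\<xi>\<in>Homs P (prod_poset Q R).
           comp1 P \<xi> \<in> Consts P Q \<longrightarrow> comp1 P (\<rho> P \<xi>) \<in> Consts P Q"
    and q: "q \<in> Field Q"
begin

lemma fin_poset_PP: "P \<in> PP \<Longrightarrow> fin_poset P"
  using reps by (simp add: poset_reps_def)

lemma rho_in_Homs:
  "P \<in> PP \<Longrightarrow> \<mu> \<in> Homs P (prod_poset Q R) \<Longrightarrow> \<rho> P \<mu> \<in> Homs P (prod_poset Q S)"
  using strong_I by (auto simp: strong_I_scheme_def I_scheme_def hom_scheme_def)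

lemma rho_inj: "P \<in> PP \<Longrightarrow> inj_on (\<rho> P) (Homs P (prod_poset Q R))"
  using strong_I by (auto simp: strong_I_scheme_def strong_scheme_def)

lemma rho_preserves:
  assumes "P \<in> PP" "P' \<in> PP" "\<xi> \<in> Homs P (prod_poset Q R)" "\<zeta> \<in> Homs P' (prod_poset Q R)"
    "x \<in> Field P" "y \<in> Field P'"
  shows "ev_le (alpha P \<xi> x) (alpha P' \<zeta> y) \<Longrightarrow>
      ev_le (alpha P (\<rho> P \<xi>) x) (alpha P' (\<rho> P' \<zeta>) y)"
    and "ev_less (alpha P \<xi> x) (alpha P' \<zeta> y) \<Longrightarrow>
      ev_less (alpha P (\<rho> P \<xi>) x) (alpha P' (\<rho> P' \<zeta>) y)"
  using assms strong_I unfolding strong_I_scheme_def I_scheme_def by blast+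

section \<open>The orbit of the constant map\<close>

lemma phi_const:
  assumes "P \<in> PP" "\<xi> \<in> Homs P R"
  shows "\<exists>c\<in>Field Q. phi \<rho> q P \<xi> i = const_map P c"
proof (induction i)
  case 0
  then show ?case using q by auto
next
  case (Suc i)
  then obtain c where c: "c \<in> Field Q" "phi \<rho> q P \<xi> i = const_map P c" by blast
  note h = const_map_in_Homs[OF Q c(1), of P]
  have "comp1 P (pair_map P (const_map P c) \<xi>) \<in> Consts P Q"
    using c(1) h assms(2) by (auto simp: comp_pair_map Homs_extensional Consts_def)
  then show ?case
    using comp1_const assms c(2) pair_map_in_Homs[OF Q R h assms(2)]
    by (auto simp: Consts_def)
qed

lemma phi_in_Homs: "P \<in> PP \<Longrightarrow> \<xi> \<in> Homs P R \<Longrightarrow> phi \<rho> q P \<xi> i \<in> Homs P Q"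
  using phi_const[of P \<xi> i] const_map_in_Homs[OF Q] by auto

lemma Phi_in_Homs: "P \<in> PP \<Longrightarrow> \<xi> \<in> Homs P R \<Longrightarrow> Phi \<rho> q P \<xi> i \<in> Homs P (prod_poset Q R)"
  unfolding Phi_def by (intro pair_map_in_Homs Q R phi_in_Homs)

lemma rho_Phi:
  assumes "P \<in> PP" "\<xi> \<in> Homs P R"
  shows "\<rho> P (Phi \<rho> q P \<xi> i) =
    pair_map P (phi \<rho> q P \<xi> (Suc i)) (comp2 P (\<rho> P (Phi \<rho> q P \<xi> i)))"
  using pair_map_comp[OF Homs_extensional[OF rho_in_Homs[OF assms(1) Phi_in_Homs[OF assms]]]]
  by (simp add: Phi_def)

lemma return_index_exists:
  assumes "P \<in> PP" "\<xi> \<in> Homs P R"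
  shows "\<exists>n. is_return_index \<rho> q P \<xi> n"
proof -
  \<comment> \<open>The self-map of \<open>Homs P Q\<close> whose iterates at
    \<open>const_map P q\<close> are the maps \<open>phi\<close>.\<close>
  define f where "f \<eta> = comp1 P (\<rho> P (pair_map P \<eta> \<xi>))" for \<eta>
  have "finite (Homs P Q)"
    using fin_poset_PP[OF assms(1)] Q by (intro finite_Homs) (auto simp: fin_poset_def)
  moreover have "inj_on f (Homs P Q)"
    using comp1_neq assms unfolding f_def inj_on_def by blast
  moreover have "f \<in> Homs P Q \<rightarrow> Homs P Q"
    unfolding f_def using assms
    by (auto intro!: comp_in_Homs(1)[OF Q S] rho_in_Homs pair_map_in_Homs Q R)
  ultimately obtain n where n: "n \<ge> 1" "(f ^^ n) (const_map P q) = const_map P q"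
    using orbit_returns const_map_in_Homs[OF Q q] by metis
  have "phi \<rho> q P \<xi> i = (f ^^ i) (const_map P q)" for i
    by (induction i) (auto simp: f_def)
  then show ?thesis
    using n by (auto simp: is_return_index_def)
qed

section \<open>Orbits belonging to comparable EV-triples\<close>

lemma phi_agree:
  assumes P: "P \<in> PP" "P' \<in> PP" and \<xi>: "\<xi> \<in> Homs P R" and \<zeta>: "\<zeta> \<in> Homs P' R"
    and x: "x \<in> Field P" and y: "y \<in> Field P'"
    and le: "ev_le (alpha P \<xi> x) (alpha P' \<zeta> y)"
  shows "\<exists>c. phi \<rho> q P \<xi> i = const_map P c \<and> phi \<rho> q P' \<zeta> i = const_map P' c"
proof (induction i)
  case 0
  then show ?case by auto
next
  case (Suc i)
  then have "ev_le (alpha P (Phi \<rho> q P \<xi> i) x) (alpha P' (Phi \<rho> q P' \<zeta> i) y)"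
    using le x y by (auto simp: Phi_def alpha_pair_const ev_le_tag)
  then have *: "ev_le (alpha P (\<rho> P (Phi \<rho> q P \<xi> i)) x) (alpha P' (\<rho> P' (Phi \<rho> q P' \<zeta> i)) y)"
    using rho_preserves(1) Phi_in_Homs P \<xi> \<zeta> x y by blast
  obtain d e where "phi \<rho> q P \<xi> (Suc i) = const_map P d" "phi \<rho> q P' \<zeta> (Suc i) = const_map P' e"
    using phi_const P \<xi> \<zeta> by meson
  \<comment> \<open>By \<open>rho_Phi\<close>, the triples compared in \<open>*\<close> carry the
    tags \<open>d\<close> and \<open>e\<close>; comparability forces these to be equal.\<close>
  moreover from this * have "d = e"
    using rho_Phi[OF P(1) \<xi>, of i] rho_Phi[OF P(2) \<zeta>, of i] x y
    by (metis alpha_pair_const ev_le_tag)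
  ultimately show ?case by blast
qed

lemma phi_cancel_Suc:
  assumes "P \<in> PP" "\<xi> \<in> Homs P R" "phi \<rho> q P \<xi> (Suc i) = phi \<rho> q P \<xi> (Suc j)"
  shows "phi \<rho> q P \<xi> i = phi \<rho> q P \<xi> j"
  using comp1_neq assms phi_in_Homs[OF assms(1,2)] by (metis phi.simps(2))

text \<open>The indices \<open>m\<close> and \<open>n\<close> may differ. By agreement at stage
  \<open>n\<close>, \<open>n\<close> is a return index for \<open>\<xi>\<close> too, and going back
  one step from the two returns of \<open>\<xi>\<close> leads to the same map.\<close>

lemma phi_agree_before_return:
  assumes P: "P \<in> PP" "P' \<in> PP" and \<xi>: "\<xi> \<in> Homs P R" and \<zeta>: "\<zeta> \<in> Homs P' R"
    and x: "x \<in> Field P" and y: "y \<in> Field P'"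
    and le: "ev_le (alpha P \<xi> x) (alpha P' \<zeta> y)"
    and m: "is_return_index \<rho> q P \<xi> m" and n: "is_return_index \<rho> q P' \<zeta> n"
  shows "\<exists>c. phi \<rho> q P \<xi> (m - 1) = const_map P c \<and> phi \<rho> q P' \<zeta> (n - 1) = const_map P' c"
proof -
  note agree = phi_agree[OF P \<xi> \<zeta> x y le]
  obtain c where "phi \<rho> q P \<xi> n = const_map P c" "phi \<rho> q P' \<zeta> n = const_map P' c"
    using agree by blast
  then have "phi \<rho> q P \<xi> n = const_map P q"
    using n const_map_eq_iff[OF fin_poset_PP[OF P(2)]] by (metis is_return_index_def)
  \<comment> \<open>Return indices are at least 1, so the truncated subtraction is exact.\<close>
  then have "phi \<rho> q P \<xi> (Suc (m - 1)) = phi \<rho> q P \<xi> (Suc (n - 1))"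
    using m n by (simp add: is_return_index_def del: phi.simps)
  then have "phi \<rho> q P \<xi> (m - 1) = phi \<rho> q P \<xi> (n - 1)"
    by (rule phi_cancel_Suc[OF P(1) \<xi>])
  then show ?thesis using agree[of "n - 1"] by simp
qed

section \<open>The induced scheme \<open>tau\<close>\<close>

lemma tau_in_Homs: "P \<in> PP \<Longrightarrow> \<xi> \<in> Homs P R \<Longrightarrow> tau \<rho> q n P \<xi> \<in> Homs P S"
  unfolding tau_def by (intro comp_in_Homs(2)[OF Q S] rho_in_Homs Phi_in_Homs)

lemma rho_Phi_return:
  assumes "P \<in> PP" "\<xi> \<in> Homs P R" "is_return_index \<rho> q P \<xi> (n P \<xi>)"
  shows "\<rho> P (Phi \<rho> q P \<xi> (n P \<xi> - 1)) = pair_map P (const_map P q) (tau \<rho> q n P \<xi>)"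
  using rho_Phi[OF assms(1,2), of "n P \<xi> - 1"] assms(3)
  by (simp add: is_return_index_def tau_def del: phi.simps)

lemma tau_strong_I_scheme:
  assumes n: "\<And>P \<xi>. P \<in> PP \<Longrightarrow> \<xi> \<in> Homs P R \<Longrightarrow> is_return_index \<rho> q P \<xi> (n P \<xi>)"
  shows "strong_I_scheme PP R S (tau \<rho> q n)"
proof -
  have hom: "hom_scheme PP R S (tau \<rho> q n)"
    by (auto simp: hom_scheme_def tau_in_Homs)
  have "\<xi> = \<zeta>"
    if P: "P \<in> PP" and h: "\<xi> \<in> Homs P R" "\<zeta> \<in> Homs P R" and eq: "tau \<rho> q n P \<xi> = tau \<rho> q n P \<zeta>"
    for P \<xi> \<zeta>
  proof -
    \<comment> \<open>At the return both images have first component \<open>const_map P q\<close>,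
      so equality of the second components suffices.\<close>
    have "\<rho> P (Phi \<rho> q P \<xi> (n P \<xi> - 1)) = \<rho> P (Phi \<rho> q P \<zeta> (n P \<zeta> - 1))"
      using rho_Phi_return[of P _ n] n P h eq by simp
    then have "Phi \<rho> q P \<xi> (n P \<xi> - 1) = Phi \<rho> q P \<zeta> (n P \<zeta> - 1)"
      using rho_inj[OF P] Phi_in_Homs P h by (auto dest: inj_onD)
    then show ?thesis
      unfolding Phi_def using comp_pair_map(2) Homs_extensional phi_in_Homs P h by metis
  qed
  then have inj: "\<forall>P\<in>PP. inj_on (tau \<rho> q n P) (Homs P R)"
    by (auto simp: inj_on_def)
  have preserves: "(ev_le (alpha P \<xi> x) (alpha P' \<zeta> y) \<longrightarrow>
        ev_le (alpha P (tau \<rho> q n P \<xi>) x) (alpha P' (tau \<rho> q n P' \<zeta>) y)) \<and>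
      (ev_less (alpha P \<xi> x) (alpha P' \<zeta> y) \<longrightarrow>
        ev_less (alpha P (tau \<rho> q n P \<xi>) x) (alpha P' (tau \<rho> q n P' \<zeta>) y))"
    if P: "P \<in> PP" "P' \<in> PP" and h: "\<xi> \<in> Homs P R" "\<zeta> \<in> Homs P' R"
      and xy: "x \<in> Field P" "y \<in> Field P'" for P P' \<xi> \<zeta> x y
  proof (cases "ev_le (alpha P \<xi> x) (alpha P' \<zeta> y)")
    case True
    let ?\<mu> = "Phi \<rho> q P \<xi> (n P \<xi> - 1)" and ?\<nu> = "Phi \<rho> q P' \<zeta> (n P' \<zeta> - 1)"
    obtain c where "phi \<rho> q P \<xi> (n P \<xi> - 1) = const_map P c"
      "phi \<rho> q P' \<zeta> (n P' \<zeta> - 1) = const_map P' c"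
      using phi_agree_before_return[OF P h xy True n n] P h by blast
    then have "alpha P ?\<mu> x = tag c (alpha P \<xi> x)" "alpha P' ?\<nu> y = tag c (alpha P' \<zeta> y)"
      using xy by (simp_all add: Phi_def alpha_pair_const)
    moreover have "alpha P (\<rho> P ?\<mu>) x = tag q (alpha P (tau \<rho> q n P \<xi>) x)"
      "alpha P' (\<rho> P' ?\<nu>) y = tag q (alpha P' (tau \<rho> q n P' \<zeta>) y)"
      using rho_Phi_return n P h xy by (simp_all add: alpha_pair_const)
    \<comment> \<open>The sources share the tag \<open>c\<close> and the images share the tag
      \<open>q\<close>, so both tags drop out of the comparisons.\<close>
    ultimately show ?thesis
      using rho_preserves[OF P Phi_in_Homs[OF P(1) h(1)] Phi_in_Homs[OF P(2) h(2)] xy]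
      by (metis ev_le_tag ev_less_tag)
  \<comment> \<open>Without \<open>ev_le\<close> there is no \<open>ev_less\<close> either, so both
    implications are vacuous.\<close>
  qed (simp add: ev_le_def)
  show ?thesis
    unfolding strong_I_scheme_def strong_scheme_def I_scheme_def
    using hom inj preserves by (intro conjI ballI) blast+
qed

end

theorem theorem9:
  fixes PP :: "'p rel set"
    and Q :: "'q rel" and R :: "'r rel" and S :: "'s rel"
    and \<rho> :: "'p rel \<Rightarrow> ('p \<Rightarrow> 'q \<times> 'r) \<Rightarrow> ('p \<Rightarrow> 'q \<times> 's)"
    and q :: 'q
  assumes "poset_reps PP"
    and "fin_poset Q" and "fin_poset R" and "fin_poset S"
    and "strong_I_scheme PP (prod_poset Q R) (prod_poset Q S) \<rho>"
    and "\<forall>P\<in>PP. \<forall>\<xi>\<in>Homs P Q. \<forall>\<zeta>\<in>Homs P Q. \<forall>\<theta>\<in>Homs P R.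
           \<xi> \<noteq> \<zeta> \<longrightarrow>
             comp1 P (\<rho> P (pair_map P \<xi> \<theta>)) \<noteq> comp1 P (\<rho> P (pair_map P \<zeta> \<theta>))"
    and "\<forall>P\<in>PP. \<forall>\<xi>\<in>Homs P (prod_poset Q R).
           comp1 P \<xi> \<in> Consts P Q \<longrightarrow> comp1 P (\<rho> P \<xi>) \<in> Consts P Q"
    and "q \<in> Field Q"
  shows "(\<forall>P\<in>PP. \<forall>\<xi>\<in>Homs P R. \<exists>n. is_return_index \<rho> q P \<xi> n) \<and>
    I_below PP R S \<and>
    (\<forall>n. (\<forall>P\<in>PP. \<forall>\<xi>\<in>Homs P R. is_return_index \<rho> q P \<xi> (n P \<xi>)) \<longrightarrow>
       strong_I_scheme PP R S (tau \<rho> q n))"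
proof -
  interpret constant_preserving_scheme PP Q R S \<rho> q
    using assms by unfold_locales
  have return: "\<forall>P\<in>PP. \<forall>\<xi>\<in>Homs P R. \<exists>n. is_return_index \<rho> q P \<xi> n"
    using return_index_exists by blast
  then have "is_return_index \<rho> q P \<xi> (SOME n. is_return_index \<rho> q P \<xi> n)"
    if "P \<in> PP" "\<xi> \<in> Homs P R" for P \<xi>
    using that by (blast intro: someI_ex)
  then have "strong_I_scheme PP R S (tau \<rho> q (\<lambda>P \<xi>. SOME n. is_return_index \<rho> q P \<xi> n))"
    by (rule tau_strong_I_scheme)
  then have "I_below PP R S"
    unfolding I_below_def by blast
  with return show ?thesis
    using tau_strong_I_scheme by blast
qed

end
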